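(* Let $\Gamma=(G,\sigma)$ be a connected signed graph with $m+1$ vertices and ordered net-Laplacian spectrum $(\alpha_1,\dots,\alpha_{m+1})$, and let $\Gamma'$ be the signed graph obtained by removing any one vertex of $\Gamma$ (with its incident edges), with ordered net-Laplacian spectrum $(\beta_1,\dots,\beta_m)$. Then \[ \alpha_p-1\leqslant\beta_p\leqslant\alpha_{p+1}+1\quad\text{for } p=1,2,\dots,m. \]
   Context: A signed graph $(G,\sigma)$ consists of a finite simple undirected graph $G$ and a map $\sigma:E(G)\to\{+1,-1\}$; it is connected if $G$ is. The adjacency matrix $A(\Gamma)$ has $(l,k)$ entry $\sigma(u_lu_k)$ if $u_l,u_k$ are adjacent and $0$ otherwise. For a vertex $u$, $d_u^+$, $d_u^-$ are the numbers of positive and negative edges at $u$ and $\mathrm{sdeg}(u)=d_u^+-d_u^-$. The net-Laplacian is $N(\Gamma)=D^{\pm}(\Gamma)-A(\Gamma)$ with $D^{\pm}(\Gamma)$ the diagonal matrix of signed degrees. The ordered spectrum is the list of eigenvalues with multiplicity in non-decreasing order. Deleting a vertex keeps the signs of the remaining edges (signed degrees are recomputed in $\Gamma'$). *)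

theory Defs
  imports
    "Graph_Theory.Digraph_Component"
    "Jordan_Normal_Form.Char_Poly"
begin

text \<open>
  A finite simple undirected graph is a \<^locale>\<open>pair_graph\<close>: a finite, loop-free, symmetric
  digraph whose arcs are pairs. The undirected edge joining \<open>u\<close> and \<open>v\<close> appears as the two
  arcs \<open>(u, v)\<close> and \<open>(v, u)\<close>. The sign is a function of the unordered pair \<open>{u, v}\<close>, so both
  arcs carry the same sign; its values on sets that are not edges are never used.
\<close>

locale signed_graph = pair_graph G for G :: "'a pair_pre_digraph" +
  fixes \<sigma> :: "'a set \<Rightarrow> int"
  assumes sign: "(u, v) \<in> parcs G \<Longrightarrow> \<sigma> {u, v} \<in> {1, -1}"

definition del_vertex :: "'a pair_pre_digraph \<Rightarrow> 'a \<Rightarrow> 'a pair_pre_digraph" where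
  "del_vertex G w = \<lparr> pverts = pverts G - {w}, parcs = {e \<in> parcs G. fst e \<noteq> w \<and> snd e \<noteq> w} \<rparr>"

lemma with_proj_del_vertex: "with_proj (del_vertex G w) = pre_digraph.del_vert (with_proj G) w"
  by (simp add: del_vertex_def pre_digraph.del_vert_def with_proj_def)

definition pos_degree :: "'a pair_pre_digraph \<Rightarrow> ('a set \<Rightarrow> int) \<Rightarrow> 'a \<Rightarrow> nat" where
  "pos_degree G \<sigma> u = card {v. (u, v) \<in> parcs G \<and> \<sigma> {u, v} = 1}"

definition neg_degree :: "'a pair_pre_digraph \<Rightarrow> ('a set \<Rightarrow> int) \<Rightarrow> 'a \<Rightarrow> nat" where
  "neg_degree G \<sigma> u = card {v. (u, v) \<in> parcs G \<and> \<sigma> {u, v} = -1}"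

definition sdeg :: "'a pair_pre_digraph \<Rightarrow> ('a set \<Rightarrow> int) \<Rightarrow> 'a \<Rightarrow> int" where
  "sdeg G \<sigma> u = int (pos_degree G \<sigma> u) - int (neg_degree G \<sigma> u)"

text \<open>
  Matrices are taken with respect to an enumeration \<open>us\<close> of the vertices, given as a list without
  repetitions.
\<close>

definition adjacency_matrix ::
    "'a pair_pre_digraph \<Rightarrow> ('a set \<Rightarrow> int) \<Rightarrow> 'a list \<Rightarrow> real mat" where
  "adjacency_matrix G \<sigma> us = mat (length us) (length us)
     (\<lambda>(l, k). if (us ! l, us ! k) \<in> parcs G then of_int (\<sigma> {us ! l, us ! k}) else 0)"

definition sdeg_matrix ::
    "'a pair_pre_digraph \<Rightarrow> ('a set \<Rightarrow> int) \<Rightarrow> 'a list \<Rightarrow> real mat" where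
  "sdeg_matrix G \<sigma> us = mat (length us) (length us)
     (\<lambda>(l, k). if l = k then of_int (sdeg G \<sigma> (us ! l)) else 0)"

definition net_laplacian ::
    "'a pair_pre_digraph \<Rightarrow> ('a set \<Rightarrow> int) \<Rightarrow> 'a list \<Rightarrow> real mat" where
  "net_laplacian G \<sigma> us = sdeg_matrix G \<sigma> us - adjacency_matrix G \<sigma> us"

text \<open>
  Only the real eigenvalues are listed, with their multiplicity as roots of the characteristic
  polynomial. By \<open>length_ordered_spectrum\<close> below, these are all eigenvalues if the matrix is
  symmetric.
\<close>

definition ordered_spectrum :: "real mat \<Rightarrow> real list" where
  "ordered_spectrum A = sorted_list_of_multiset (proots (char_poly A))"

lemma set_ordered_spectrum:
  assumes "A \<in> carrier_mat n n"
  shows "set (ordered_spectrum A) = {x. eigenvalue A x}"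
proof -
  have "char_poly A \<noteq> 0"
    using degree_monic_char_poly[OF assms] by auto
  then show ?thesis
    by (simp add: ordered_spectrum_def eigenvalue_root_char_poly[OF assms])
qed

lemma symmetric_real_root:
  fixes A :: "real mat" and z :: complex
  assumes A: "A \<in> carrier_mat n n" and sym: "transpose_mat A = A"
    and ev: "eigenvalue (map_mat of_real A) z"
  shows "z \<in> \<real>"
proof -
  define C :: "complex mat" where "C = map_mat of_real A"
  have C: "C \<in> carrier_mat n n"
    using A by (simp add: C_def)
  have entry: "C $$ (i, j) = of_real (A $$ (i, j))" if "i < n" "j < n" for i j
    using A that by (simp add: C_def)
  have Asym: "A $$ (i, j) = A $$ (j, i)" if "i < n" "j < n" for i j
    using sym A that by (metis carrier_matD index_transpose_mat(1))
  from ev obtain v where v: "v \<in> carrier_vec n" "v \<noteq> 0\<^sub>v n" "C *\<^sub>v v = z \<cdot>\<^sub>v v"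
    unfolding eigenvalue_def eigenvector_def C_def[symmetric] using C by auto
  have row: "(\<Sum>j<n. of_real (A $$ (i, j)) * v $ j) = z * v $ i" if "i < n" for i
  proof -
    have "(C *\<^sub>v v) $ i = (\<Sum>j<n. C $$ (i, j) * v $ j)"
      using C v(1) that by (simp add: scalar_prod_def lessThan_atLeast0)
    then show ?thesis
      using v(1,3) that entry by simp
  qed
  define s where "s = (\<Sum>i<n. v $ i * cnj (v $ i))"
  have "z * s = (\<Sum>i<n. (z * v $ i) * cnj (v $ i))"
    by (simp add: s_def sum_distrib_left mult.assoc)
  also have "\<dots> = (\<Sum>i<n. \<Sum>j<n. of_real (A $$ (i, j)) * v $ j * cnj (v $ i))"
    by (simp add: row[symmetric] sum_distrib_right)
  also have "\<dots> = (\<Sum>j<n. \<Sum>i<n. of_real (A $$ (i, j)) * v $ j * cnj (v $ i))"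
    by (rule sum.swap)
  also have "\<dots> = (\<Sum>j<n. v $ j * cnj (\<Sum>i<n. of_real (A $$ (j, i)) * v $ i))"
    by (simp add: sum_distrib_left Asym mult_ac)
  also have "\<dots> = cnj z * s"
  proof -
    have "(\<Sum>j<n. v $ j * cnj (\<Sum>i<n. of_real (A $$ (j, i)) * v $ i)) = (\<Sum>j<n. v $ j * cnj (z * v $ j))"
      by (intro sum.cong refl) (simp only: row lessThan_iff)
    then show ?thesis
      by (simp add: s_def sum_distrib_left mult_ac)
  qed
  finally have eq: "z * s = cnj z * s" .
  have s: "s = of_real (\<Sum>i<n. (cmod (v $ i))\<^sup>2)"
    by (simp add: s_def complex_norm_square[symmetric] del: of_real_power)
  have "\<exists>i<n. v $ i \<noteq> 0"
    using v(1,2) by (metis carrier_vecD eq_vecI index_zero_vec)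
  then have "(\<Sum>i<n. (cmod (v $ i))\<^sup>2) \<noteq> 0"
    by (auto simp: sum_nonneg_eq_0_iff)
  then have "s \<noteq> 0"
    unfolding s by (metis of_real_eq_0_iff)
  with eq show ?thesis
    by (simp add: Reals_cnj_iff)
qed

lemma length_ordered_spectrum:
  assumes A: "A \<in> carrier_mat n n" and sym: "transpose_mat A = A"
  shows "length (ordered_spectrum A) = n"
proof -
  interpret h: map_poly_inj_idom_hom "of_real :: real \<Rightarrow> complex" ..
  define C :: "complex mat" where "C = map_mat of_real A"
  have C: "C \<in> carrier_mat n n"
    using A by (simp add: C_def)
  obtain as where as: "char_poly C = (\<Prod>a\<leftarrow>as. [:- a, 1:])" "length as = n"
    using char_poly_factorized[OF C] by auto
  have "a \<in> \<real>" if "a \<in> set as" for a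
  proof (rule symmetric_real_root[OF A sym])
    have "poly (char_poly C) a = 0"
      using that unfolding as(1) by (induction as) auto
    then show "eigenvalue (map_mat of_real A) a"
      using eigenvalue_root_char_poly[OF C] by (simp add: C_def)
  qed
  then have lin: "map (\<lambda>a. [:- a, 1:]) as = map (\<lambda>a. map_poly of_real [:- Re a, 1:]) as"
    by (simp add: map_poly_pCons)
  have "map_poly of_real (char_poly A) = (\<Prod>a\<leftarrow>as. map_poly of_real [:- Re a, 1:] :: complex poly)"
    using as(1) of_real_hom.char_poly_hom[OF A] unfolding C_def lin by metis
  also have "\<dots> = map_poly of_real (\<Prod>a\<leftarrow>as. [:- Re a, 1:])"
    by (induction as) (simp_all only: list.map prod_list.Nil prod_list.Cons h.hom_mult h.hom_one)
  finally have "char_poly A = (\<Prod>a\<leftarrow>as. [:- Re a, 1:])"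
    by (simp only: h.eq_iff)
  moreover have "size (proots (\<Prod>a\<leftarrow>bs. [:- Re a, 1:])) = length bs" for bs
  proof (induction bs)
    case (Cons b bs)
    have "(\<Prod>a\<leftarrow>bs. [:- Re a, 1:]) \<noteq> 0"
      by (auto simp: prod_list_zero_iff)
    then show ?case
      using Cons.IH by (simp add: proots_mult del: mult_pCons_left)
  qed simp
  ultimately show ?thesis
    using as(2) by (simp add: ordered_spectrum_def flip: size_mset)
qed

lemma (in signed_graph) net_laplacian_symmetric:
  "transpose_mat (net_laplacian G \<sigma> us) = net_laplacian G \<sigma> us"
proof -
  have "(u, v) \<in> parcs G \<longleftrightarrow> (v, u) \<in> parcs G" for u v
    using pair_sym_arcs by (auto simp: symmetric_def sym_def)
  then show ?thesis
    by (intro eq_matI)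
      (auto simp: net_laplacian_def sdeg_matrix_def adjacency_matrix_def insert_commute)
qed

lemma (in signed_graph) length_net_laplacian_spectrum:
  "length (ordered_spectrum (net_laplacian G \<sigma> us)) = length us"
proof (rule length_ordered_spectrum[OF _ net_laplacian_symmetric])
  show "net_laplacian G \<sigma> us \<in> carrier_mat (length us) (length us)"
    by (simp add: net_laplacian_def sdeg_matrix_def adjacency_matrix_def minus_mat_def)
qed

lemma (in signed_graph) signed_graph_del_vertex: "signed_graph (del_vertex G w) \<sigma>"
proof
  show "symmetric (with_proj (del_vertex G w))"
    using pair_sym_arcs by (auto simp: symmetric_def sym_def del_vertex_def)
qed (use sign pair_finite_verts pair_finite_arcs pair_no_loops in
      \<open>auto simp: del_vertex_def dest: arc_fst_in_verts arc_snd_in_verts\<close>)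

end

theory Submission
  imports Defs
begin

text \<open>
  Up to the order of the vertices, the principal submatrix of \<open>N(\<Gamma>)\<close> obtained by deleting the
  row and column of \<open>w\<close> is \<open>N(\<Gamma>')\<close> plus a diagonal matrix whose entries are the changes of the
  signed degrees, hence lie in \<open>{-1, 0, 1}\<close>. So the bounds combine Cauchy interlacing with
  Weyl's inequality. Both come at once from a dimension count: suitable eigenvectors of the large
  matrix and (embedded) eigenvectors of the small one span subspaces whose dimensions add up to
  more than the dimension of the space, and a common nonzero vector lets one compare the two
  quadratic forms.
\<close>

section \<open>Orthogonal diagonalization of real symmetric matrices\<close>

lemma orthogonal_mat_with_first_column:
  fixes v :: "real vec"
  assumes v: "v \<in> carrier_vec (Suc n)" and unit: "v \<bullet> v = 1"
  obtains W where "W \<in> carrier_mat (Suc n) (Suc n)"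
    "transpose_mat W * W = 1\<^sub>m (Suc n)" "col W 0 = v"
proof -
  define u where "u i = v $ i - (if i = 0 then 1 else 0)" for i
  define c where "c = 1 / (1 - v $ 0)"
  \<comment> \<open>The Householder reflection exchanging \<open>v\<close> and the first unit vector. If these coincide, then
    \<open>c = 1 / 0 = 0\<close> and \<open>W\<close> is the identity, as it should be.\<close>
  define W where "W = mat (Suc n) (Suc n) (\<lambda>(i, j). (if i = j then 1 else 0) - c * u i * u j)"
  have vv: "(\<Sum>i<Suc n. v $ i * v $ i) = 1"
    using v unit by (simp add: scalar_prod_def lessThan_atLeast0)
  have uu: "(\<Sum>i<Suc n. u i * u i) = 2 * (1 - v $ 0)"
    using vv unfolding u_def lessThan_Suc_eq_insert_0
    by (simp add: sum.reindex algebra_simps)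
  \<comment> \<open>As \<open>W\<close> is symmetric, \<open>cc\<close> is exactly what makes the
    two terms in \<open>u i * u j\<close> of its square cancel. For \<open>v $ 0 = 1\<close> both
    sides are 0.\<close>
  have cc: "c * c * (\<Sum>i<Suc n. u i * u i) = 2 * c"
    unfolding uu c_def by (cases "v $ 0 = 1") (simp_all add: divide_simps)
  \<comment> \<open>Column 0 of \<open>W\<close> is the first unit vector minus
    \<open>c * u 0\<close> times \<open>u\<close>; by \<open>u0\<close> this is the unit vector plus
    \<open>u\<close>, that is \<open>v\<close>.\<close>
  have u0: "c * u i * u 0 = - u i" if "i < Suc n" for i
  proof (cases "v $ 0 = 1")
    case True
    then have "(\<Sum>i<Suc n. u i * u i) = 0" using uu by simp
    then have "u i = 0" using that by (simp add: sum_nonneg_eq_0_iff del: sum.lessThan_Suc)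
    then show ?thesis by simp
  next
    case False
    then show ?thesis by (simp add: c_def u_def field_simps)
  qed
  show thesis
  proof
    show "W \<in> carrier_mat (Suc n) (Suc n)" by (simp add: W_def)
    show "transpose_mat W * W = 1\<^sub>m (Suc n)"
    proof (rule eq_matI)
      fix i j assume "i < dim_row (1\<^sub>m (Suc n) :: real mat)" "j < dim_col (1\<^sub>m (Suc n) :: real mat)"
      then have ij: "i < Suc n" "j < Suc n" by auto
      have "(transpose_mat W * W) $$ (i, j) = (\<Sum>k<Suc n. W $$ (k, i) * W $$ (k, j))"
        using ij by (simp add: W_def scalar_prod_def lessThan_atLeast0 del: sum.lessThan_Suc)
      also have "\<dots> = (\<Sum>k<Suc n. (if k = i then (if i = j then 1 else 0) - c * u i * u j else 0)
           - (if k = j then c * u i * u j else 0) + c * c * u i * u j * (u k * u k))"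
        using ij by (intro sum.cong refl) (auto simp: W_def algebra_simps)
      also have "\<dots> = (if i = j then 1 else 0) - 2 * c * u i * u j
          + u i * u j * (c * c * (\<Sum>k<Suc n. u k * u k))"
        using ij by (simp add: sum.distrib sum_subtractf sum.delta sum_distrib_left mult_ac
            del: sum.lessThan_Suc)
      also have "\<dots> = (if i = j then 1 else 0)" unfolding cc by simp
      finally show "(transpose_mat W * W) $$ (i, j) = 1\<^sub>m (Suc n) $$ (i, j)" using ij by simp
    qed (simp_all add: W_def)
    show "col W 0 = v"
      using v u0 by (intro eq_vecI) (auto simp: W_def u_def)
  qed
qed

text \<open>The head of a sorted list is its minimum, so inserting \<open>e\<close> puts it in
  front. The hypothesis has the form in which the smallest eigenvalue is chosen below, once the root
  multiset is known to split off \<open>e\<close>.\<close>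

lemma sorted_list_of_multiset_add_hd:
  assumes "e = hd (sorted_list_of_multiset (add_mset e M))"
  shows "sorted_list_of_multiset (add_mset e M) = e # sorted_list_of_multiset M"
proof -
  obtain ys where ys: "sorted_list_of_multiset (add_mset e M) = e # ys"
    using assms by (cases "sorted_list_of_multiset (add_mset e M)")
      (auto simp del: sorted_list_of_multiset_insert dest: arg_cong[where f = mset])
  have "e \<le> x" if "x \<in># M" for x
  proof -
    have "x \<in> set (e # ys)" unfolding ys[symmetric] using that
      by (simp del: sorted_list_of_multiset_insert)
    moreover have "sorted (e # ys)"
      unfolding ys[symmetric] by (rule sorted_sorted_list_of_multiset)
    ultimately show ?thesis by auto
  qed
  then show ?thesis by (simp add: insort_is_Cons)
qed

text \<open>Deflation: an orthogonal change of basis splits off the smallest eigenvalue, and the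
  induction hypothesis treats the remaining block. Taking the smallest one each time makes the
  diagonal appear in the order of \<open>ordered_spectrum\<close>.\<close>

theorem real_symmetric_diagonalization:
  assumes "A \<in> carrier_mat n n" and "transpose_mat A = A"
  shows "\<exists>P. P \<in> carrier_mat n n \<and> transpose_mat P * P = 1\<^sub>m n \<and>
    transpose_mat P * A * P = mat_diag n (\<lambda>i. ordered_spectrum A ! i)"
  using assms
proof (induction n arbitrary: A)
  case 0
  then show ?case by (intro exI[of _ "1\<^sub>m 0"]) (auto intro!: eq_matI simp: mat_diag_def)
next
  case (Suc n A)
  note A = Suc.prems(1) and sym = Suc.prems(2)
  define e where "e = hd (ordered_spectrum A)"
  \<comment> \<open>A real eigenvalue exists because the spectrum of a symmetric matrix has full
    length \<open>Suc n\<close>, hence is nonempty.\<close>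
  have "e \<in> set (ordered_spectrum A)"
    using length_ordered_spectrum[OF A sym] unfolding e_def by (metis length_0_conv list.set_sel(1) nat.distinct(1))
  then have "eigenvalue A e" using set_ordered_spectrum[OF A] by auto
  then obtain v0 where v0: "v0 \<in> carrier_vec (Suc n)" "v0 \<noteq> 0\<^sub>v (Suc n)" "A *\<^sub>v v0 = e \<cdot>\<^sub>v v0"
    using A unfolding eigenvalue_def eigenvector_def by auto
  have pos: "v0 \<bullet> v0 > 0"
    using v0(1,2) conjugate_square_greater_0_vec[of v0 "Suc n"] by simp
  define v where "v = (1 / sqrt (v0 \<bullet> v0)) \<cdot>\<^sub>v v0"
  have v: "v \<in> carrier_vec (Suc n)" using v0(1) by (simp add: v_def)
  have Av: "A *\<^sub>v v = e \<cdot>\<^sub>v v"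
    using A v0 unfolding v_def by (simp add: mult_mat_vec smult_smult_assoc mult.commute)
  have "v \<bullet> v = 1"
    using v0(1) pos unfolding v_def by (simp add: real_sqrt_mult_self)
  from orthogonal_mat_with_first_column[OF v this] obtain W where
    W: "W \<in> carrier_mat (Suc n) (Suc n)" and WW: "transpose_mat W * W = 1\<^sub>m (Suc n)"
    and W0: "col W 0 = v" by auto
  have WW': "W * transpose_mat W = 1\<^sub>m (Suc n)"
    using mat_mult_left_right_inverse[OF _ W WW] W by simp
  \<comment> \<open>In the basis of the columns of \<open>W\<close> the eigenvector \<open>v\<close>
    becomes the first unit vector. So column 0 of \<open>B\<close> is \<open>e\<close> times that
    vector, and symmetry clears row 0 as well.\<close>
  define B where "B = transpose_mat W * A * W"
  have B: "B \<in> carrier_mat (Suc n) (Suc n)" using A W by (simp add: B_def)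
  have Bsym: "transpose_mat B = B"
    unfolding B_def using A W sym
    by (simp add: transpose_mult[of _ "Suc n" "Suc n" _ "Suc n"] assoc_mult_mat[of _ "Suc n" "Suc n" _ "Suc n" _ "Suc n"])
  have Bentry: "B $$ (i, j) = B $$ (j, i)" if "i < Suc n" "j < Suc n" for i j
    using arg_cong[OF Bsym, of "\<lambda>M. M $$ (i, j)"] B that by simp
  have "B = transpose_mat W * (A * W)"
    unfolding B_def using A W by (intro assoc_mult_mat) auto
  then have "col B 0 = transpose_mat W *\<^sub>v col (A * W) 0"
    using A W by (simp only:, intro col_mult2) auto
  also have "col (A * W) 0 = A *\<^sub>v col W 0"
    using A W by (intro col_mult2) auto
  also have "transpose_mat W *\<^sub>v (A *\<^sub>v col W 0) = e \<cdot>\<^sub>v (transpose_mat W *\<^sub>v col W 0)"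
    unfolding W0 Av using W v by (simp add: mult_mat_vec)
  also have "transpose_mat W *\<^sub>v col W 0 = unit_vec (Suc n) 0"
    using col_mult2[of "transpose_mat W" "Suc n" "Suc n" W "Suc n" 0] W unfolding WW by simp
  finally have B0: "col B 0 = e \<cdot>\<^sub>v unit_vec (Suc n) 0" .
  have Bi0: "B $$ (i, 0) = (if i = 0 then e else 0)" if "i < Suc n" for i
    using arg_cong[OF B0, of "\<lambda>v. v $ i"] B that by (simp add: unit_vec_def)
  have B0i: "B $$ (0, i) = (if i = 0 then e else 0)" if "i < Suc n" for i
    using Bi0[OF that] Bentry[of 0 i] that by simp
  define C where "C = mat n n (\<lambda>(i, j). B $$ (Suc i, Suc j))"
  have C: "C \<in> carrier_mat n n" by (simp add: C_def)
  have Csym: "transpose_mat C = C"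
    unfolding C_def using Bentry by (intro eq_matI) auto
  define E where "E = mat 1 1 (\<lambda>_. e)"
  have E: "E \<in> carrier_mat 1 1" by (simp add: E_def)
  have Bblock: "B = four_block_mat E (0\<^sub>m 1 n) (0\<^sub>m n 1) C"
    using B Bi0 B0i by (intro eq_matI) (auto simp: E_def C_def)
  \<comment> \<open>Similarity and the block form factor the characteristic polynomial, which shows
    that the spectrum of \<open>C\<close> is that of \<open>A\<close> with one copy of
    \<open>e\<close> removed.\<close>
  have "similar_mat B A"
    using A B W WW WW' by (intro similar_matI[of _ _ "transpose_mat W" W "Suc n"]) (auto simp: B_def)
  then have "char_poly A = char_poly B"
    by (rule char_poly_similar[symmetric])
  also have "\<dots> = char_poly E * char_poly C"
    unfolding Bblock by (rule char_poly_four_block_zeros_col[OF E _ C]) simp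
  also have "char_poly E = [:-e, 1:]"
    by (simp add: E_def char_poly_defs det_def sign_def)
  finally have "char_poly A = [:-e, 1:] * char_poly C" .
  moreover have "char_poly C \<noteq> 0" using degree_monic_char_poly[OF C] by auto
  ultimately have roots: "proots (char_poly A) = add_mset e (proots (char_poly C))"
    by (simp add: proots_mult del: mult_pCons_left)
  have spec: "ordered_spectrum A = e # ordered_spectrum C"
    unfolding ordered_spectrum_def roots
    by (rule sorted_list_of_multiset_add_hd) (unfold roots[symmetric], rule e_def[unfolded ordered_spectrum_def])
  from Suc.IH[OF C Csym] obtain P where P: "P \<in> carrier_mat n n" "transpose_mat P * P = 1\<^sub>m n"
    "transpose_mat P * C * P = mat_diag n (\<lambda>i. ordered_spectrum C ! i)" by auto
  \<comment> \<open>\<open>R\<close> extends the diagonalizing matrix of \<open>C\<close> by the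
    identity on the first coordinate; \<open>W * R\<close> then diagonalizes
    \<open>A\<close>.\<close>
  define R where "R = four_block_mat (1\<^sub>m 1) (0\<^sub>m 1 n) (0\<^sub>m n 1) P"
  have R: "R \<in> carrier_mat (Suc n) (Suc n)" unfolding R_def using four_block_carrier_mat[of "1\<^sub>m 1" 1 1 P n n] P by simp
  have RT: "transpose_mat R = four_block_mat (1\<^sub>m 1) (0\<^sub>m 1 n) (0\<^sub>m n 1) (transpose_mat P)"
    unfolding R_def using P by (subst transpose_four_block_mat[of _ 1 1 _ n _ n]) auto
  have RR: "transpose_mat R * R = 1\<^sub>m (Suc n)"
    unfolding RT unfolding R_def using P
    by (subst mult_four_block_mat[of _ 1 1 _ n _ n _ _ 1 _ n]) (auto intro!: eq_matI)
  have RBR: "transpose_mat R * B * R = mat_diag (Suc n) (\<lambda>i. ordered_spectrum A ! i)"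
  proof -
    have "transpose_mat R * B = four_block_mat E (0\<^sub>m 1 n) (0\<^sub>m n 1) (transpose_mat P * C)"
      unfolding RT Bblock using P E C
      by (subst mult_four_block_mat[of _ 1 1 _ n _ n _ _ 1 _ n]) auto
    then have "transpose_mat R * B * R = four_block_mat E (0\<^sub>m 1 n) (0\<^sub>m n 1) (transpose_mat P * C * P)"
      unfolding R_def using P E C
      by (simp, subst mult_four_block_mat[of _ 1 1 _ n _ n _ _ 1 _ n]) auto
    also have "\<dots> = mat_diag (Suc n) (\<lambda>i. ordered_spectrum A ! i)"
      unfolding P(3) spec by (intro eq_matI) (auto simp: E_def mat_diag_def nth_Cons')
    finally show ?thesis .
  qed
  show ?case
  proof (intro exI conjI)
    show "W * R \<in> carrier_mat (Suc n) (Suc n)" using W R by simp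
    have T: "transpose_mat (W * R) = transpose_mat R * transpose_mat W"
      using W R by (rule transpose_mult)
    have "transpose_mat (W * R) * (W * R) = transpose_mat R * (transpose_mat W * W) * R"
      unfolding T using W R by (simp add: assoc_mult_mat[of _ "Suc n" "Suc n" _ "Suc n" _ "Suc n"])
    then show "transpose_mat (W * R) * (W * R) = 1\<^sub>m (Suc n)"
      unfolding WW using R RR by simp
    have "transpose_mat (W * R) * A * (W * R) = transpose_mat R * B * R"
      unfolding T B_def using W R A by (simp add: assoc_mult_mat[of _ "Suc n" "Suc n" _ "Suc n" _ "Suc n"])
    then show "transpose_mat (W * R) * A * (W * R) = mat_diag (Suc n) (\<lambda>i. ordered_spectrum A ! i)"
      unfolding RBR .
  qed
qed

section \<open>Underdetermined systems and quadratic forms\<close>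

text \<open>Padding the coefficient matrix with zero rows makes it square. Since there are fewer
  equations than unknowns, row \<open>card R\<close> is such a zero row, so the determinant vanishes
  and the kernel is nontrivial.\<close>

lemma homogeneous_system_solution:
  fixes f :: "'a \<Rightarrow> 'b \<Rightarrow> 'c :: field"
  assumes "finite R" "finite T" "card R < card T"
  obtains y where "\<And>r. r \<in> R \<Longrightarrow> (\<Sum>t\<in>T. f r t * y t) = 0" "\<exists>t\<in>T. y t \<noteq> 0"
proof -
  define q where "q = card T"
  obtain g where g: "bij_betw g {0..<q} T"
    using ex_bij_betw_nat_finite[OF assms(2)] q_def by auto
  obtain h where h: "bij_betw h {0..<card R} R"
    using ex_bij_betw_nat_finite[OF assms(1)] by auto
  define C where "C = mat q q (\<lambda>(i, j). if i < card R then f (h i) (g j) else 0)"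
  have C: "C \<in> carrier_mat q q" by (simp add: C_def)
  have "C = mat\<^sub>r q q (\<lambda>i. if i = card R then 0\<^sub>v q else row C i)"
    by (intro eq_matI) (auto simp: C_def)
  then have "det C = 0"
    using det_row_0[of "card R" q "row C"] C assms(3) by (simp add: q_def)
  then obtain v where v: "v \<in> carrier_vec q" "v \<noteq> 0\<^sub>v q" "C *\<^sub>v v = 0\<^sub>v q"
    using det_0_iff_vec_prod_zero_field[OF C] by auto
  define y where "y = (\<lambda>t. v $ (inv_into {0..<q} g t))"
  have yg: "y (g j) = v $ j" if "j < q" for j
    using g that by (simp add: y_def bij_betw_inv_into_left)
  show thesis
  proof
    fix r assume "r \<in> R"
    then obtain i where i: "i < card R" "r = h i"
      using h by (metis atLeastLessThan_iff bij_betw_def imageE)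
    have "(\<Sum>t\<in>T. f r t * y t) = (\<Sum>j\<in>{0..<q}. f r (g j) * y (g j))"
      by (rule sum.reindex_bij_betw[OF g, symmetric])
    also have "\<dots> = (C *\<^sub>v v) $ i"
      using i assms(3) v(1) yg by (simp add: C_def scalar_prod_def q_def)
    finally show "(\<Sum>t\<in>T. f r t * y t) = 0"
      using v(3) i assms(3) by (simp add: q_def)
  next
    obtain j where "j < q" "v $ j \<noteq> 0"
      using v(1,2) by (metis carrier_vecD eq_vecI index_zero_vec)
    then show "\<exists>t\<in>T. y t \<noteq> 0"
      using yg g by (intro bexI[of _ "g j"]) (auto simp: bij_betw_def)
  qed
qed

lemma scalar_prod_orthogonal:
  fixes P :: "'a :: comm_ring_1 mat"
  assumes P: "P \<in> carrier_mat n k" "transpose_mat P * P = 1\<^sub>m k" and x: "x \<in> carrier_vec k"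
  shows "(P *\<^sub>v x) \<bullet> (P *\<^sub>v x) = x \<bullet> x"
proof -
  have "transpose_mat P *\<^sub>v (P *\<^sub>v x) = (transpose_mat P * P) *\<^sub>v x"
    using P x by (intro assoc_mult_mat_vec[symmetric]) auto
  then have "x \<bullet> x = (transpose_mat P *\<^sub>v (P *\<^sub>v x)) \<bullet> x"
    using P x by simp
  also have "\<dots> = (P *\<^sub>v x) \<bullet> (P *\<^sub>v x)"
    using P x by (intro transpose_vec_mult_scalar) auto
  finally show ?thesis ..
qed

lemma scalar_prod_congruence:
  fixes P :: "'a :: comm_ring_1 mat"
  assumes P: "P \<in> carrier_mat n k" and A: "A \<in> carrier_mat n n" and x: "x \<in> carrier_vec k"
  shows "(P *\<^sub>v x) \<bullet> (A *\<^sub>v (P *\<^sub>v x)) = x \<bullet> ((transpose_mat P * A * P) *\<^sub>v x)"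
proof -
  have "x \<bullet> ((transpose_mat P * A * P) *\<^sub>v x) = x \<bullet> (transpose_mat P *\<^sub>v (A *\<^sub>v (P *\<^sub>v x)))"
    using P A x by (simp add: assoc_mult_mat_vec[of _ k n _ k] assoc_mult_mat_vec[of _ k n _ n])
  also have "\<dots> = (transpose_mat P *\<^sub>v (A *\<^sub>v (P *\<^sub>v x))) \<bullet> x"
    using P A x by (intro comm_scalar_prod[of _ k]) auto
  also have "\<dots> = (A *\<^sub>v (P *\<^sub>v x)) \<bullet> (P *\<^sub>v x)"
    using P A x by (intro transpose_vec_mult_scalar) auto
  also have "\<dots> = (P *\<^sub>v x) \<bullet> (A *\<^sub>v (P *\<^sub>v x))"
    using P A x by (intro comm_scalar_prod[of _ n]) auto
  finally show ?thesis ..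
qed

lemma scalar_prod_mat_diag:
  fixes x :: "'a :: comm_ring_1 vec"
  assumes "x \<in> carrier_vec n"
  shows "x \<bullet> (mat_diag n a *\<^sub>v x) = (\<Sum>i<n. a i * (x $ i)\<^sup>2)"
proof -
  have "(mat_diag n a *\<^sub>v x) $ i = a i * x $ i" if "i < n" for i
  proof -
    have "(mat_diag n a *\<^sub>v x) $ i = (\<Sum>j\<in>{0..<n}. (if i = j then a j * x $ j else 0))"
      using assms that by (simp add: mat_diag_def scalar_prod_def if_distrib[of "\<lambda>c. c * _"] cong: if_cong)
    then show ?thesis using that by simp
  qed
  then show ?thesis
    using assms by (auto simp: scalar_prod_def lessThan_atLeast0 power2_eq_square mat_diag_def mult_ac intro!: sum.cong)
qed

section \<open>Comparison of eigenvalues and perturbed interlacing\<close>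

text \<open>The eigenvectors of \<open>A\<close> indexed by \<open>S\<close> and the images under
  the isometry \<open>J\<close> of those of \<open>B\<close> indexed by \<open>T\<close> span spaces
  with a common nonzero vector. If every \<open>a s\<close> exceeded every \<open>b t + c\<close>,
  the form of \<open>A\<close> at this vector would be both too large and too small. No order on
  \<open>a\<close> and \<open>b\<close> is assumed, so the lemma also applies to negated
  matrices.\<close>

lemma diagonalized_eigenvalues_comparable:
  fixes A B E J :: "real mat"
  assumes A: "A \<in> carrier_mat n n" and B: "B \<in> carrier_mat k k" and E: "E \<in> carrier_mat k k"
    and J: "J \<in> carrier_mat n k" "transpose_mat J * J = 1\<^sub>m k"
    and P: "P \<in> carrier_mat n n" "transpose_mat P * P = 1\<^sub>m n" "transpose_mat P * A * P = mat_diag n a"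
    and Q: "Q \<in> carrier_mat k k" "transpose_mat Q * Q = 1\<^sub>m k" "transpose_mat Q * B * Q = mat_diag k b"
    and JAJ: "transpose_mat J * A * J = B + E"
    and bound: "\<And>x. x \<in> carrier_vec k \<Longrightarrow> x \<bullet> (E *\<^sub>v x) \<le> c * (x \<bullet> x)"
    and ST: "S \<subseteq> {..<n}" "T \<subseteq> {..<k}" "n < card S + card T"
  shows "\<exists>s\<in>S. \<exists>t\<in>T. a s \<le> b t + c"
proof (rule ccontr)
  assume "\<not> ?thesis"
  then have gap: "b t + c < a s" if "s \<in> S" "t \<in> T" for s t using that by force
  have fin: "finite S" "finite T" using ST finite_subset by auto
  \<comment> \<open>Column \<open>t\<close> of \<open>M\<close> holds the coordinates of the
    embedded \<open>t\<close>-th eigenvector of \<open>B\<close> in the eigenbasis of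
    \<open>A\<close>. The system below asks for a combination over \<open>T\<close> with no
    component outside \<open>S\<close>.\<close>
  define M where "M = transpose_mat P * J * Q"
  have M: "M \<in> carrier_mat n k" using P J Q by (simp add: M_def)
  have "card ({..<n} - S) < card T"
    using ST card_mono[OF _ ST(1)] by (simp add: card_Diff_subset fin)
  then obtain y0 where y0: "\<And>r. r \<in> {..<n} - S \<Longrightarrow> (\<Sum>t\<in>T. M $$ (r, t) * y0 t) = 0"
    and nz: "\<exists>t\<in>T. y0 t \<noteq> 0"
    using homogeneous_system_solution[of "{..<n} - S" T "\<lambda>r t. M $$ (r, t)"] fin by blast
  define y where "y = vec k (\<lambda>t. if t \<in> T then y0 t else 0)"
  have y: "y \<in> carrier_vec k" by (simp add: y_def)
  have sumT: "(\<Sum>t<k. F t * (y $ t)\<^sup>2) = (\<Sum>t\<in>T. F t * (y $ t)\<^sup>2)" for F :: "nat \<Rightarrow> real"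
    using ST(2) by (intro sum.mono_neutral_right) (auto simp: y_def)
  define x where "x = Q *\<^sub>v y"
  have x: "x \<in> carrier_vec k" using Q y by (simp add: x_def)
  \<comment> \<open>The common vector is \<open>J *\<^sub>v x\<close>: it has coordinates
    \<open>y\<close>, supported on \<open>T\<close>, on the side of \<open>B\<close>, and
    \<open>z\<close>, supported on \<open>S\<close>, on the side of \<open>A\<close>.\<close>
  define z where "z = transpose_mat P *\<^sub>v (J *\<^sub>v x)"
  have z: "z \<in> carrier_vec n" using P J x by (simp add: z_def)
  have PP: "P * transpose_mat P = 1\<^sub>m n"
    using mat_mult_left_right_inverse[OF _ P(1,2)] P by simp
  have "P *\<^sub>v z = (P * transpose_mat P) *\<^sub>v (J *\<^sub>v x)"
    unfolding z_def using P J x by (intro assoc_mult_mat_vec[symmetric]) auto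
  then have Pz: "P *\<^sub>v z = J *\<^sub>v x" using J x PP by simp
  have "z = M *\<^sub>v y"
    unfolding z_def x_def M_def using P J Q y
    by (simp add: assoc_mult_mat_vec[of _ n k _ k] assoc_mult_mat_vec[of _ n n _ k])
  then have "z $ r = (\<Sum>t<k. M $$ (r, t) * y $ t)" if "r < n" for r
    using M y that by (simp add: scalar_prod_def lessThan_atLeast0)
  moreover have "(\<Sum>t<k. M $$ (r, t) * y $ t) = (\<Sum>t\<in>T. M $$ (r, t) * y0 t)" for r
    using ST(2) by (intro sum.mono_neutral_cong_right) (auto simp: y_def)
  ultimately have z0: "z $ r = 0" if "r < n" "r \<notin> S" for r
    using y0 that by simp
  have sumS: "(\<Sum>s<n. F s * (z $ s)\<^sup>2) = (\<Sum>s\<in>S. F s * (z $ s)\<^sup>2)" for F :: "nat \<Rightarrow> real"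
    using ST(1) z0 by (intro sum.mono_neutral_right) auto
  have yy: "y \<bullet> y = (\<Sum>t\<in>T. (y $ t)\<^sup>2)" 
    using scalar_prod_mat_diag[OF y, of "\<lambda>_. 1"] sumT[of "\<lambda>_. 1"] y by simp
  have zz: "z \<bullet> z = (\<Sum>s\<in>S. (z $ s)\<^sup>2)" 
    using scalar_prod_mat_diag[OF z, of "\<lambda>_. 1"] sumS[of "\<lambda>_. 1"] z by simp
  have xx: "x \<bullet> x = y \<bullet> y"
    unfolding x_def using Q y by (intro scalar_prod_orthogonal) auto
  have "z \<bullet> z = (J *\<^sub>v x) \<bullet> (J *\<^sub>v x)"
    using scalar_prod_orthogonal[OF P(1,2) z] Pz by simp
  then have zy: "z \<bullet> z = y \<bullet> y" using scalar_prod_orthogonal[OF J x] xx by simp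
  obtain t0 where t0: "t0 \<in> T" "y0 t0 \<noteq> 0" using nz by auto
  have ypos: "y \<bullet> y > 0"
    unfolding yy using t0 ST(2) fin by (intro sum_pos2[of _ t0]) (auto simp: y_def)
  \<comment> \<open>By finiteness of \<open>T\<close>, \<open>\<mu>\<close> separates the two
    families: it bounds every \<open>b t + c\<close> and still lies strictly below every
    \<open>a s\<close>.\<close>
  define \<mu> where "\<mu> = Max ((\<lambda>t. b t + c) ` T)"
  have \<mu>: "b t + c \<le> \<mu>" if "t \<in> T" for t
    using that fin by (simp add: \<mu>_def)
  have "\<mu> \<in> (\<lambda>t. b t + c) ` T"
    unfolding \<mu>_def using fin t0 by (intro Max_in) auto
  then have \<mu>a: "\<mu> < a s" if "s \<in> S" for s using gap that by auto
  obtain s0 where s0: "s0 \<in> S" "z $ s0 \<noteq> 0"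
    using ypos unfolding zy[symmetric] zz
    by (cases "\<forall>s\<in>S. z $ s = 0") auto
  \<comment> \<open>Strictness comes from the nonzero coordinate \<open>z $ s0\<close>. The chain
    evaluates the form of \<open>A\<close> at the common vector, splits it by \<open>JAJ\<close>,
    and returns to \<mu> times the same squared norm.\<close>
  have "\<mu> * (z \<bullet> z) < (\<Sum>s\<in>S. a s * (z $ s)\<^sup>2)"
    unfolding zz sum_distrib_left
  proof (rule sum_strict_mono_ex1[OF fin(1)])
    show "\<forall>s\<in>S. \<mu> * (z $ s)\<^sup>2 \<le> a s * (z $ s)\<^sup>2"
      using \<mu>a by (auto intro!: mult_right_mono simp: less_imp_le)
    show "\<exists>s\<in>S. \<mu> * (z $ s)\<^sup>2 < a s * (z $ s)\<^sup>2"
      using s0 \<mu>a by (intro bexI[of _ s0]) auto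
  qed
  also have "\<dots> = z \<bullet> (mat_diag n a *\<^sub>v z)"
    using scalar_prod_mat_diag[OF z] sumS by simp
  also have "\<dots> = (J *\<^sub>v x) \<bullet> (A *\<^sub>v (J *\<^sub>v x))"
    using scalar_prod_congruence[OF P(1) A z] unfolding P(3) Pz ..
  also have "\<dots> = x \<bullet> (B *\<^sub>v x) + x \<bullet> (E *\<^sub>v x)"
    unfolding scalar_prod_congruence[OF J(1) A x] JAJ using B E x
    by (simp add: add_mult_distrib_mat_vec[of _ k k] scalar_prod_add_distrib[of _ k])
  also have "\<dots> \<le> y \<bullet> (mat_diag k b *\<^sub>v y) + c * (y \<bullet> y)"
    using bound[OF x] scalar_prod_congruence[OF Q(1) B y] unfolding Q(3) xx
    by (simp flip: x_def)
  also have "\<dots> = (\<Sum>t\<in>T. (b t + c) * (y $ t)\<^sup>2)"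
    using scalar_prod_mat_diag[OF y] sumT unfolding yy
    by (simp add: sum.distrib sum_distrib_left algebra_simps)
  also have "\<dots> \<le> \<mu> * (y \<bullet> y)"
    unfolding yy sum_distrib_left using \<mu> by (intro sum_mono mult_right_mono) auto
  finally show False unfolding zy by simp
qed

text \<open>The lower bound compares the upper end of the spectrum of \<open>A\<close> with the
  lower end of that of \<open>B\<close>. The upper bound is the same argument for
  \<open>- A\<close>, \<open>- B\<close> and \<open>- E\<close>, which is why \<open>bound\<close>
  is two-sided.\<close>

theorem perturbed_interlacing:
  fixes A B E J :: "real mat"
  assumes A: "A \<in> carrier_mat n n" "transpose_mat A = A"
    and B: "B \<in> carrier_mat k k" "transpose_mat B = B" and E: "E \<in> carrier_mat k k"
    and J: "J \<in> carrier_mat n k" "transpose_mat J * J = 1\<^sub>m k"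
    and JAJ: "transpose_mat J * A * J = B + E"
    and bound: "\<And>x. x \<in> carrier_vec k \<Longrightarrow> \<bar>x \<bullet> (E *\<^sub>v x)\<bar> \<le> c * (x \<bullet> x)"
    and p: "p < k" "k \<le> n"
  shows "ordered_spectrum A ! p - c \<le> ordered_spectrum B ! p"
    and "ordered_spectrum B ! p \<le> ordered_spectrum A ! (p + n - k) + c"
proof -
  let ?a = "\<lambda>i. ordered_spectrum A ! i" and ?b = "\<lambda>i. ordered_spectrum B ! i"
  have a: "?a i \<le> ?a j" if "i \<le> j" "j < n" for i j
    using that length_ordered_spectrum[OF A]
    by (intro sorted_nth_mono) (auto simp: ordered_spectrum_def)
  have b: "?b i \<le> ?b j" if "i \<le> j" "j < k" for i j
    using that length_ordered_spectrum[OF B]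
    by (intro sorted_nth_mono) (auto simp: ordered_spectrum_def)
  obtain P where P: "P \<in> carrier_mat n n" "transpose_mat P * P = 1\<^sub>m n"
    "transpose_mat P * A * P = mat_diag n ?a"
    using real_symmetric_diagonalization[OF A] by auto
  obtain Q where Q: "Q \<in> carrier_mat k k" "transpose_mat Q * Q = 1\<^sub>m k"
    "transpose_mat Q * B * Q = mat_diag k ?b"
    using real_symmetric_diagonalization[OF B] by auto
  have neg: "transpose_mat X * (- Y) * X = - (transpose_mat X * Y * X)"
    if "X \<in> carrier_mat r s" "Y \<in> carrier_mat r r" for X Y :: "real mat" and r s
    using that by (simp del: assoc_mult_mat)
  have neg_diag: "- mat_diag r f = mat_diag r (\<lambda>i. - f i)" for r and f :: "nat \<Rightarrow> real"
    by (intro eq_matI) (auto simp: mat_diag_def)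
  have "x \<bullet> (E *\<^sub>v x) \<le> c * (x \<bullet> x)" if "x \<in> carrier_vec k" for x
    using bound[OF that] by simp
  \<comment> \<open>The index sets have \<open>n - p\<close> and \<open>p + 1\<close> elements,
    together \<open>n + 1\<close>, just enough for the dimension count. Monotonicity then moves
    \<open>s\<close> down and \<open>t\<close> up to \<open>p\<close>.\<close>
  from diagonalized_eigenvalues_comparable[OF A(1) B(1) E J P Q JAJ this, of "{p..<n}" "{..p}"]
  have "\<exists>s\<in>{p..<n}. \<exists>t\<in>{..p}. ?a s \<le> ?b t + c"
    using p by force
  then obtain s t where "s \<in> {p..<n}" "t \<le> p" "?a s \<le> ?b t + c"
    by auto
  with a[of p s] b[of t p] p show "?a p - c \<le> ?b p" by auto
  have bound': "x \<bullet> ((- E) *\<^sub>v x) \<le> c * (x \<bullet> x)" if "x \<in> carrier_vec k" for x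
    using bound[OF that] that E by (simp add: uminus_mult_mat_vec)
  have JAJ': "transpose_mat J * (- A) * J = - B + (- E)"
    unfolding neg[OF J(1) A(1)] JAJ using B E by (intro eq_matI) auto
  have P': "transpose_mat P * (- A) * P = mat_diag n (\<lambda>i. - ?a i)"
    unfolding neg[OF P(1) A(1)] P(3) neg_diag ..
  have Q': "transpose_mat Q * (- B) * Q = mat_diag k (\<lambda>i. - ?b i)"
    unfolding neg[OF Q(1) B(1)] Q(3) neg_diag ..
  \<comment> \<open>Again the sizes \<open>p + n - k + 1\<close> and \<open>k - p\<close> add up to
    \<open>n + 1\<close>; this fixes the shift \<open>n - k\<close> in the upper bound.\<close>
  have "\<exists>s\<in>{..p + n - k}. \<exists>t\<in>{p..<k}. - ?a s \<le> - ?b t + c"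
    using p by (intro diagonalized_eigenvalues_comparable[OF _ _ _ J P(1,2) P' Q(1,2) Q' JAJ' bound'])
      (auto simp: A B E)
  then obtain s t where "s \<le> p + n - k" "t \<in> {p..<k}" "- ?a s \<le> - ?b t + c"
    by auto
  moreover have "p + n - k < n" using p by linarith
  ultimately show "?b p \<le> ?a (p + n - k) + c"
    using a[of s "p + n - k"] b[of p t] by auto
qed

section \<open>Net-Laplacians under vertex deletion\<close>

lemma net_laplacian_carrier:
  "net_laplacian G \<sigma> us \<in> carrier_mat (length us) (length us)"
  by (simp add: net_laplacian_def sdeg_matrix_def adjacency_matrix_def minus_mat_def)

text \<open>Expressing the diagonal condition through vertices instead of positions allows entries
  to be compared across two different enumerations.\<close>

lemma net_laplacian_entry:
  assumes "distinct us" "i < length us" "j < length us"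
  shows "net_laplacian G \<sigma> us $$ (i, j) =
    (if us ! i = us ! j then of_int (sdeg G \<sigma> (us ! i)) else 0) -
    (if (us ! i, us ! j) \<in> parcs G then of_int (\<sigma> {us ! i, us ! j}) else 0)"
  using assms
  by (auto simp: net_laplacian_def sdeg_matrix_def adjacency_matrix_def nth_eq_iff_index_eq)

text \<open>The positive and the negative degree each drop by 0 or 1, and they enter with opposite
  signs.\<close>

lemma sdeg_del_vertex:
  assumes "u \<noteq> w"
  shows "\<bar>sdeg G \<sigma> u - sdeg (del_vertex G w) \<sigma> u\<bar> \<le> 1"
proof -
  have card: "card S - 1 \<le> card (S - {w})" "card (S - {w}) \<le> card S" for S :: "'a set"
    by (simp_all add: card_Diff_singleton_if card_Diff1_le)
  have "{v. (u, v) \<in> parcs (del_vertex G w) \<and> \<sigma> {u, v} = c} =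
      {v. (u, v) \<in> parcs G \<and> \<sigma> {u, v} = c} - {w}" for c
    using assms by (auto simp: del_vertex_def)
  then show ?thesis
    using card[of "{v. (u, v) \<in> parcs G \<and> \<sigma> {u, v} = 1}"]
      card[of "{v. (u, v) \<in> parcs G \<and> \<sigma> {u, v} = -1}"]
    by (simp add: sdeg_def pos_degree_def neg_degree_def)
qed

theorem theorem3p4:
  fixes G :: "'a pair_pre_digraph" and \<sigma> :: "'a set \<Rightarrow> int"
    and w :: 'a and us vs :: "'a list" and m :: nat and \<alpha> \<beta> :: "real list"
  assumes "signed_graph G \<sigma>"
    and "Digraph_Component.connected (with_proj G)"
    and "card (pverts G) = m + 1"
    and "w \<in> pverts G"
    and "distinct us" and "set us = pverts G"
    and "distinct vs" and "set vs = pverts (del_vertex G w)"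
    and "\<alpha> = ordered_spectrum (net_laplacian G \<sigma> us)"
    and "\<beta> = ordered_spectrum (net_laplacian (del_vertex G w) \<sigma> vs)"
  shows "\<forall>p\<in>{1..m}. \<alpha> ! (p - 1) - 1 \<le> \<beta> ! (p - 1) \<and> \<beta> ! (p - 1) \<le> \<alpha> ! p + 1"
proof
  fix p assume p: "p \<in> {1..m}"
  let ?G' = "del_vertex G w"
  define A where "A = net_laplacian G \<sigma> us"
  define B where "B = net_laplacian ?G' \<sigma> vs"
  have us: "length us = m + 1"
    using assms(3,5,6) distinct_card by metis
  have set_vs: "set vs = pverts G - {w}" using assms(8) by (simp add: del_vertex_def)
  have vs: "length vs = m"
    using distinct_card[OF assms(7)] assms(3,4) unfolding set_vs
    by (simp add: card_Diff_singleton)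
  have A: "A \<in> carrier_mat (m + 1) (m + 1)" "transpose_mat A = A"
    using net_laplacian_carrier[of G \<sigma> us] signed_graph.net_laplacian_symmetric[OF assms(1)] us
    by (auto simp: A_def)
  have B: "B \<in> carrier_mat m m" "transpose_mat B = B"
    using net_laplacian_carrier[of ?G' \<sigma> vs] vs
      signed_graph.net_laplacian_symmetric[OF signed_graph.signed_graph_del_vertex[OF assms(1)]]
    by (auto simp: B_def)
  define e where "e i = (of_int (sdeg G \<sigma> (vs ! i) - sdeg ?G' \<sigma> (vs ! i)) :: real)" for i
  define E where "E = mat_diag m e"
  have E: "E \<in> carrier_mat m m" by (simp add: E_def)
  have vs_mem: "vs ! j \<in> pverts G" "vs ! j \<noteq> w" if "j < m" for j
    using nth_mem[of j vs] vs that unfolding set_vs by auto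
  have e: "\<bar>e i\<bar> \<le> 1" if "i < m" for i
    using sdeg_del_vertex[OF vs_mem(2)[OF that], of G \<sigma>] unfolding e_def by linarith
  \<comment> \<open>Column \<open>j\<close> is the unit vector at the position of
    \<open>vs ! j\<close> in \<open>us\<close>. Since \<open>us\<close> and \<open>vs\<close> are
    unrelated enumerations, \<open>J\<close> encodes both the omission of \<open>w\<close> and the
    reordering.\<close>
  define J :: "real mat" where "J = mat (m + 1) m (\<lambda>(i, j). if us ! i = vs ! j then 1 else 0)"
  have J: "J \<in> carrier_mat (m + 1) m" by (simp add: J_def)
  have pick: "(\<Sum>l<m + 1. J $$ (l, j) * F l) = F l'" if "j < m" "l' < m + 1" "us ! l' = vs ! j" for F j l'
  proof -
    have "us ! l = vs ! j \<longleftrightarrow> l = l'" if "l < m + 1" for l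
      using nth_eq_iff_index_eq[OF assms(5), of l l'] that \<open>l' < m + 1\<close> \<open>us ! l' = vs ! j\<close> us by simp
    then have "(\<Sum>l<m + 1. J $$ (l, j) * F l) = (\<Sum>l<m + 1. if l = l' then F l else 0)"
      using \<open>j < m\<close> by (intro sum.cong refl) (simp add: J_def)
    then show ?thesis using that by simp
  qed
  define \<iota> where "\<iota> j = (SOME l. l < m + 1 \<and> us ! l = vs ! j)" for j
  have \<iota>: "\<iota> j < m + 1" "us ! \<iota> j = vs ! j" if "j < m" for j
  proof -
    have "\<exists>l. l < m + 1 \<and> us ! l = vs ! j"
      using vs_mem(1)[OF that] us unfolding assms(6)[symmetric] by (auto simp: in_set_conv_nth)
    from someI_ex[OF this] show "\<iota> j < m + 1" "us ! \<iota> j = vs ! j" by (simp_all add: \<iota>_def)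
  qed
  \<comment> \<open>Multiplying by \<open>J\<close> only selects rows or columns at the positions
    \<open>\<iota>\<close>, so \<open>transpose_mat J * A * J\<close> is a reordered principal
    submatrix of \<open>A\<close>.\<close>
  have JTX: "(transpose_mat J * X) $$ (i, j) = X $$ (\<iota> i, j)"
    if "i < m" "X \<in> carrier_mat (m + 1) k" "j < k" for i j k and X :: "real mat"
  proof -
    have "(transpose_mat J * X) $$ (i, j) = (\<Sum>l<m + 1. J $$ (l, i) * X $$ (l, j))"
      using that J by (simp add: scalar_prod_def lessThan_atLeast0)
    then show ?thesis using pick[OF that(1) \<iota>[OF that(1)]] by simp
  qed
  have XJ: "(X * J) $$ (i, j) = X $$ (i, \<iota> j)"
    if "i < k" "X \<in> carrier_mat k (m + 1)" "j < m" for i j k and X :: "real mat"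
  proof -
    have "(X * J) $$ (i, j) = (\<Sum>l<m + 1. J $$ (l, j) * X $$ (i, l))"
      using that J by (simp add: scalar_prod_def lessThan_atLeast0 mult.commute)
    then show ?thesis using pick[OF that(3) \<iota>[OF that(3)]] by simp
  qed
  have JJ: "transpose_mat J * J = 1\<^sub>m m"
  proof (rule eq_matI)
    fix i j assume "i < dim_row (1\<^sub>m m :: real mat)" "j < dim_col (1\<^sub>m m :: real mat)"
    then have ij: "i < m" "j < m" by auto
    then show "(transpose_mat J * J) $$ (i, j) = 1\<^sub>m m $$ (i, j)"
      using JTX[OF ij(1) J ij(2)] \<iota> vs assms(7) by (simp add: J_def nth_eq_iff_index_eq)
  qed (use J in auto)
  have JAJ: "transpose_mat J * A * J = B + E"
  proof (rule eq_matI)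
    fix i j assume "i < dim_row (B + E)" "j < dim_col (B + E)"
    then have ij: "i < m" "j < m" using E by auto
    \<comment> \<open>Adjacency and signs between the remaining vertices are unchanged, so the two
      matrices differ only by the signed degrees on the diagonal, collected in
      \<open>E\<close>.\<close>
    have arcs: "(vs ! i, vs ! j) \<in> parcs ?G' \<longleftrightarrow> (vs ! i, vs ! j) \<in> parcs G"
      using vs_mem ij by (simp add: del_vertex_def)
    have "(transpose_mat J * A * J) $$ (i, j) = (transpose_mat J * A) $$ (i, \<iota> j)"
      using ij A J by (intro XJ) auto
    also have "\<dots> = A $$ (\<iota> i, \<iota> j)"
      using ij A \<iota> by (intro JTX) auto
    also have "\<dots> = B $$ (i, j) + E $$ (i, j)"
      using ij \<iota> us vs assms(5,7)
      by (auto simp: A_def B_def E_def e_def mat_diag_def net_laplacian_entry arcs nth_eq_iff_index_eq)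
    finally show "(transpose_mat J * A * J) $$ (i, j) = (B + E) $$ (i, j)" using ij B E by simp
  qed (use J B E in auto)
  have bound: "\<bar>x \<bullet> (E *\<^sub>v x)\<bar> \<le> 1 * (x \<bullet> x)" if x: "x \<in> carrier_vec m" for x
  proof -
    have "\<bar>x \<bullet> (E *\<^sub>v x)\<bar> \<le> (\<Sum>i<m. \<bar>e i * (x $ i)\<^sup>2\<bar>)"
      unfolding E_def scalar_prod_mat_diag[OF x] by (rule sum_abs)
    also have "\<dots> \<le> (\<Sum>i<m. 1 * (x $ i)\<^sup>2)"
      using e by (intro sum_mono) (simp add: abs_mult mult_left_le_one_le)
    also have "\<dots> = x \<bullet> x"
      using scalar_prod_mat_diag[OF x, of "\<lambda>_. 1"] x by simp
    finally show ?thesis by simp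
  qed
  show "\<alpha> ! (p - 1) - 1 \<le> \<beta> ! (p - 1) \<and> \<beta> ! (p - 1) \<le> \<alpha> ! p + 1"
    \<comment> \<open>Lists are indexed from 0, so position \<open>p - 1\<close> is used; with
      \<open>n = m + 1\<close> and \<open>k = m\<close> the upper index \<open>p - 1 + n - k\<close>
      is \<open>p\<close>.\<close>
    using perturbed_interlacing[OF A B E J JJ JAJ bound, of "p - 1"] p
    unfolding assms(9,10) A_def B_def by auto
qed

end
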